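(* For each positive integer $D$ and $L\ge3D/2$, one can find a finite set $\mathcal{S}_D$ of intensities (with respect to Lebesgue measure on $[0,1]$) with the following properties: (i) it is a subset of some $D$-dimensional affine subspace of $\mathbb{L}_2([0,1],dx)$; (ii) $\sup_{s\in\mathcal{S}_D}\|s\|_\infty\le L$; (iii) for any estimator $\hat s(\boldsymbol{X})$ with values in $\mathbb{L}_2([0,1],dx)$ based on a Poisson process $\boldsymbol{X}$ with intensity $s$, $$\sup_{s\in\mathcal{S}_D}\mathbb{E}_s\left[\|\hat s-s\|_2^2\right]\ge(DL/24)\exp[-2/7].$$
   Context: An intensity on $[0,1]$ is a nonnegative integrable function $s$ with respect to Lebesgue measure. A Poisson process with intensity $s$ is a point process $\boldsymbol{X}=\{X_1,\dots,X_N\}$ on $[0,1]$ with $N$ Poisson with parameter $\int_0^1s(x)\,dx$ and, conditionally on $N$, the $X_i$ i.i.d. with density $s/\int_0^1s(x)\,dx$; $\mathbb{E}_s$ is the expectation when $\boldsymbol{X}$ has intensity $s$. Estimators are measurable functions of $\boldsymbol{X}$. $\|\cdot\|_2$ and $\|\cdot\|_\infty$ are the norms of $\mathbb{L}_2([0,1],dx)$ and $\mathbb{L}_\infty([0,1],dx)$. *)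

theory Defs
  imports "HOL-Probability.Probability"
begin

abbreviation leb01 :: "real measure" where
  "leb01 \<equiv> restrict_space lborel {0..1}"

definition square_integrable :: "(real \<Rightarrow> real) \<Rightarrow> bool" where
  "square_integrable f \<longleftrightarrow>
     f \<in> borel_measurable leb01 \<and> integrable leb01 (\<lambda>x. (f x)\<^sup>2)"

lemma square_integrable_measurable [measurable_dest]:
  "square_integrable f \<Longrightarrow> f \<in> borel_measurable leb01"
  by (simp add: square_integrable_def)

lemma square_integrable_times:
  assumes "square_integrable f" "square_integrable g"
  shows "integrable leb01 (\<lambda>x. f x * g x)"
proof (rule Bochner_Integration.integrable_bound)
  show "integrable leb01 (\<lambda>x. (f x)\<^sup>2 + (g x)\<^sup>2)"
    using assms by (simp add: square_integrable_def)
  show "(\<lambda>x. f x * g x) \<in> borel_measurable leb01"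
    using assms by (auto simp: square_integrable_def intro: borel_measurable_times)
  have "\<bar>a * b\<bar> \<le> a\<^sup>2 + b\<^sup>2" for a b :: real
    using sum_squares_bound[of a b] sum_squares_bound[of "- a" b]
    by (simp add: abs_if)
  then show "AE x in leb01. norm (f x * g x) \<le> norm ((f x)\<^sup>2 + (g x)\<^sup>2)"
    by (auto intro!: AE_I2)
qed

lemma square_integrable_add:
  assumes "square_integrable f" "square_integrable g"
  shows "square_integrable (\<lambda>x. f x + g x)"
  using assms square_integrable_times[OF assms]
  by (auto simp: square_integrable_def power2_sum mult.assoc)

lemma square_integrable_cmult:
  "square_integrable f \<Longrightarrow> square_integrable (\<lambda>x. c * f x)"
  by (auto simp: square_integrable_def power_mult_distrib)

lemma square_integrable_zero: "square_integrable (\<lambda>_. 0)"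
  by (simp add: square_integrable_def)

text \<open>
  $L_2([0,1],dx)$ as a space of classes modulo a.e. equality. Every Lebesgue measurable function has
  a Borel version, so restricting to Borel functions loses nothing.
\<close>

quotient_type l2 = "real \<Rightarrow> real" / partial:
  "\<lambda>f g. square_integrable f \<and> square_integrable g \<and> (AE x in leb01. f x = g x)"
proof (rule part_equivpI)
  show "\<exists>f. square_integrable f \<and> square_integrable f \<and> (AE x in leb01. f x = f x)"
    using square_integrable_zero by auto
  show "symp (\<lambda>f g. square_integrable f \<and> square_integrable g \<and> (AE x in leb01. f x = g x))"
    by (rule sympI) (auto simp: eq_commute)
  show "transp (\<lambda>f g. square_integrable f \<and> square_integrable g \<and> (AE x in leb01. f x = g x))"
  proof (rule transpI; elim conjE; intro conjI)
    fix f g h :: "real \<Rightarrow> real"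
    assume "AE x in leb01. f x = g x" "AE x in leb01. g x = h x"
    then show "AE x in leb01. f x = h x" by eventually_elim simp
  qed
qed

instantiation l2 :: real_vector
begin

lift_definition zero_l2 :: l2 is "\<lambda>_. 0"
  by (simp add: square_integrable_zero)

lift_definition plus_l2 :: "l2 \<Rightarrow> l2 \<Rightarrow> l2" is "\<lambda>f g x. f x + g x"
  by (auto intro: square_integrable_add)

lift_definition scaleR_l2 :: "real \<Rightarrow> l2 \<Rightarrow> l2" is "\<lambda>c f x. c * f x"
  by (auto intro: square_integrable_cmult)

definition uminus_l2 :: "l2 \<Rightarrow> l2" where "uminus_l2 v = (- 1) *\<^sub>R v"
definition minus_l2 :: "l2 \<Rightarrow> l2 \<Rightarrow> l2" where "minus_l2 v w = v + (- w)"

instance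
proof
  fix u v w :: l2 and a b :: real
  show "u + v + w = u + (v + w)"
    by transfer (auto intro!: square_integrable_add simp: add.assoc)
  show "u + v = v + u"
    by transfer (auto intro!: square_integrable_add simp: add.commute)
  show "0 + u = u"
    by transfer auto
  show "- u + u = 0"
    unfolding uminus_l2_def
    by transfer (auto intro!: square_integrable_add square_integrable_zero
        square_integrable_cmult[where c = "- 1", simplified])
  show "u - v = u + - v"
    by (simp add: minus_l2_def)
  show "a *\<^sub>R (u + v) = a *\<^sub>R u + a *\<^sub>R v"
    by transfer (auto intro!: square_integrable_add square_integrable_cmult simp: distrib_left)
  show "(a + b) *\<^sub>R u = a *\<^sub>R u + b *\<^sub>R u"
    by transfer (auto intro!: square_integrable_add square_integrable_cmult simp: distrib_right)
  show "a *\<^sub>R b *\<^sub>R u = (a * b) *\<^sub>R u"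
    by transfer (auto intro!: square_integrable_cmult simp: mult.assoc)
  show "1 *\<^sub>R u = u"
    by transfer auto
qed

end

instantiation l2 :: real_inner
begin

lift_definition inner_l2 :: "l2 \<Rightarrow> l2 \<Rightarrow> real" is
  "\<lambda>f g. integral\<^sup>L leb01 (\<lambda>x. f x * g x)"
proof (elim conjE)
  fix f f' g g' :: "real \<Rightarrow> real"
  assume *: "square_integrable f" "square_integrable f'"
            "square_integrable g" "square_integrable g'"
    and eq: "AE x in leb01. f x = f' x" "AE x in leb01. g x = g' x"
  from eq have "AE x in leb01. f x * g x = f' x * g' x"
    by eventually_elim simp
  then show "integral\<^sup>L leb01 (\<lambda>x. f x * g x) = integral\<^sup>L leb01 (\<lambda>x. f' x * g' x)"
    using * by (intro integral_cong_AE) (auto simp: square_integrable_def)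
qed

definition norm_l2 :: "l2 \<Rightarrow> real" where "norm_l2 v = sqrt (inner v v)"
definition sgn_l2 :: "l2 \<Rightarrow> l2" where "sgn_l2 v = v /\<^sub>R norm v"
definition dist_l2 :: "l2 \<Rightarrow> l2 \<Rightarrow> real" where "dist_l2 v w = norm (v - w)"
definition uniformity_l2 :: "(l2 \<times> l2) filter" where
  "uniformity_l2 = (INF e\<in>{0 <..}. principal {(v, w). dist v w < e})"
definition open_l2 :: "l2 set \<Rightarrow> bool" where
  "open_l2 U = (\<forall>v\<in>U. \<forall>\<^sub>F (v', w) in uniformity. v' = v \<longrightarrow> w \<in> U)"

instance
proof
  fix u v w :: l2 and a :: real
  show "dist u v = norm (u - v)"
    by (simp add: dist_l2_def)
  show "sgn u = u /\<^sub>R norm u"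
    by (simp add: sgn_l2_def)
  show "uniformity = (INF e\<in>{0 <..}. principal {(x, y :: l2). dist x y < e})"
    by (simp add: uniformity_l2_def)
  show "open U = (\<forall>x\<in>U. \<forall>\<^sub>F (x', y) in uniformity. x' = x \<longrightarrow> y \<in> U)" for U :: "l2 set"
    by (simp add: open_l2_def)
  show "inner u v = inner v u"
    by transfer (simp add: mult.commute)
  show "inner (u + v) w = inner u w + inner v w"
    by transfer (auto simp: distrib_right square_integrable_times)
  show "inner (a *\<^sub>R u) v = a * inner u v"
    by transfer (auto simp: mult.assoc)
  show "0 \<le> inner u u"
    by transfer (auto intro!: integral_nonneg_AE)
  show "inner u u = 0 \<longleftrightarrow> u = 0"
  proof transfer
    fix f :: "real \<Rightarrow> real"
    assume f: "square_integrable f \<and> square_integrable f \<and> (AE x in leb01. f x = f x)"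
    then have "integral\<^sup>L leb01 (\<lambda>x. f x * f x) = 0 \<longleftrightarrow> (AE x in leb01. f x * f x = 0)"
      by (intro integral_nonneg_eq_0_iff_AE) (auto simp: square_integrable_times)
    then show "(integral\<^sup>L leb01 (\<lambda>x. f x * f x) = 0) \<longleftrightarrow>
        square_integrable f \<and> square_integrable (\<lambda>_. 0) \<and> (AE x in leb01. f x = 0)"
      using f square_integrable_zero by simp
  qed
  show "norm u = sqrt (inner u u)"
    by (simp add: norm_l2_def)
qed

end

text \<open>The class of a function; meaningful only for square integrable functions.\<close>

definition l2_class :: "(real \<Rightarrow> real) \<Rightarrow> l2" where
  "l2_class f = abs_l2 f"

lemma norm_l2_class:
  assumes "square_integrable f"
  shows "norm (l2_class f) = sqrt (integral\<^sup>L leb01 (\<lambda>x. (f x)\<^sup>2))"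
  unfolding norm_eq_sqrt_inner l2_class_def using assms
  by (simp add: inner_l2.abs_eq eq_onp_def power2_eq_square)

lemma l2_class_eq_iff:
  assumes "square_integrable f" "square_integrable g"
  shows "l2_class f = l2_class g \<longleftrightarrow> (AE x in leb01. f x = g x)"
  unfolding l2_class_def using assms Quotient3_rel[OF Quotient3_l2, of f g] by auto

lemma l2_class_surj: "\<exists>f. square_integrable f \<and> v = l2_class f"
  unfolding l2_class_def
  using Quotient3_abs_rep[OF Quotient3_l2, of v] Quotient3_rep_reflp[OF Quotient3_l2, of v]
  by metis

definition affine_subspace_dim :: "'a::real_vector set \<Rightarrow> nat \<Rightarrow> bool" where
  "affine_subspace_dim A d \<longleftrightarrow>
     (\<exists>a B. finite B \<and> card B = d \<and> independent B \<and> A = (+) a ` span B)"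

definition Linf_norm :: "(real \<Rightarrow> real) \<Rightarrow> ereal" where
  "Linf_norm f = esssup leb01 (\<lambda>x. ereal \<bar>f x\<bar>)"

definition intensity :: "(real \<Rightarrow> real) \<Rightarrow> bool" where
  "intensity s \<longleftrightarrow> (\<forall>x\<in>{0..1}. 0 \<le> s x) \<and> integrable leb01 s"

text \<open>
  Realizations are finite sets rather than multisets of points: the points have a density, so
  ties have probability zero.
\<close>

definition configurations :: "real set measure" where
  "configurations = sigma (Fpow {0..1})
     {{X \<in> Fpow {0..1}. card (X \<inter> A) = k} | A k. A \<in> sets borel}"

text \<open>The library's Poisson distribution requires a positive parameter.\<close>

definition poisson_law :: "real \<Rightarrow> nat pmf" where
  "poisson_law r = (if r = 0 then return_pmf 0 else poisson_pmf r)"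

text \<open>
  The law of the random set of the points $X_i$, $i < N$. If $s$ is a.e. zero, then $N = 0$ almost
  surely, and the kernel at $0$ is the point mass at the empty set, so that the meaningless
  density $s / 0$ plays no role.
\<close>

definition poisson_process :: "(real \<Rightarrow> real) \<Rightarrow> real set measure" where
  "poisson_process s =
     (let r = integral\<^sup>L leb01 s in
      measure_pmf (poisson_law r) \<bind>
        (\<lambda>N. distr (PiM {..<N} (\<lambda>_. density leb01 (\<lambda>x. ennreal (s x / r)))) configurations
               (\<lambda>x. x ` {..<N})))"

lemma space_configurations: "space configurations = Fpow {0..1}"
  unfolding configurations_def by (rule space_measure_of) auto

lemma points_measurable:
  fixes N :: nat
  assumes M: "sets M = sets leb01"
  shows "(\<lambda>x. x ` {..<N}) \<in> PiM {..<N} (\<lambda>_. M) \<rightarrow>\<^sub>M configurations"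
  unfolding configurations_def
proof (rule measurable_measure_of)
  have sp: "space M = {0..1}"
    using sets_eq_imp_space_eq[OF M] by (simp add: space_restrict_space)
  show "(\<lambda>x. x ` {..<N}) \<in> space (PiM {..<N} (\<lambda>_. M)) \<rightarrow> Fpow {0..1}"
    by (auto simp: space_PiM sp Fpow_def PiE_def Pi_def intro!: finite_imageI)
  fix Y :: "real set set" assume "Y \<in> {{X \<in> Fpow {0..1}. card (X \<inter> A) = k} | A k. A \<in> sets borel}"
  then obtain A :: "real set" and k where A: "A \<in> sets borel"
    and Y: "Y = {X \<in> Fpow {0..1}. card (X \<inter> A) = k}"
    by auto
  let ?P = "PiM {..<N} (\<lambda>_. M)"
  have comp: "(\<lambda>x. x i) \<in> borel_measurable ?P" if "i < N" for i
  proof -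
    have "(\<lambda>x. x i) \<in> ?P \<rightarrow>\<^sub>M M" using that by simp
    moreover have "(\<lambda>x. x) \<in> M \<rightarrow>\<^sub>M borel"
      using measurable_restrict_space1[of "\<lambda>x. x" lborel borel "{0..1::real}"]
      by (simp add: measurable_cong_sets[OF M refl])
    ultimately show ?thesis by (rule measurable_compose)
  qed
  \<comment> \<open>Count a point at its first index.\<close>
  define F where "F x = {i \<in> {..<N}. x i \<in> A \<and> (\<forall>j\<in>{..<i}. x j \<noteq> x i)}" for x :: "nat \<Rightarrow> real"
  have card_F: "card (x ` {..<N} \<inter> A) = card (F x)" for x
  proof -
    have "inj_on x (F x)"
    proof (rule inj_onI)
      fix i j assume "i \<in> F x" "j \<in> F x" "x i = x j"
      then show "i = j"
        by (cases i j rule: linorder_cases) (auto simp: F_def)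
    qed
    moreover have "x ` F x = x ` {..<N} \<inter> A"
    proof (intro equalityI subsetI)
      fix y assume "y \<in> x ` {..<N} \<inter> A"
      then obtain i where i: "i < N" "x i = y" "y \<in> A" by auto
      define m where "m = (LEAST m. x m = y)"
      have "x m = y" "m \<le> i"
        unfolding m_def using i by (auto intro: LeastI Least_le)
      moreover have "x j \<noteq> y" if "j < m" for j
        using not_less_Least[of j "\<lambda>m. x m = y"] that unfolding m_def by simp
      ultimately show "y \<in> x ` F x"
        using i unfolding F_def by (intro image_eqI[of _ _ m]) auto
    qed (auto simp: F_def)
    ultimately show ?thesis by (metis card_image)
  qed
  have "(\<lambda>x. \<Sum>i<N. if x i \<in> A \<and> (\<forall>j\<in>{..<i}. x j \<noteq> x i) then 1 else 0 :: nat)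
          \<in> ?P \<rightarrow>\<^sub>M count_space UNIV"
  proof (rule measurable_sum_nat)
    fix i assume i: "i \<in> {..<N}"
    have 1: "Measurable.pred ?P (\<lambda>x. \<forall>j\<in>{..<i}. x j \<noteq> x i)"
    proof (rule pred_intros_finite)
      fix j assume "j \<in> {..<i}"
      with i have [measurable]: "(\<lambda>x. x i) \<in> borel_measurable ?P" "(\<lambda>x. x j) \<in> borel_measurable ?P"
        by (auto intro: comp)
      show "Measurable.pred ?P (\<lambda>x. x j \<noteq> x i)"
        unfolding pred_def by (rule borel_measurable_neq) fact+
    qed simp
    have 2: "Measurable.pred ?P (\<lambda>x. x i \<in> A)"
      by (rule pred_sets2[OF A comp]) (use i in simp)
    show "(\<lambda>x. if x i \<in> A \<and> (\<forall>j\<in>{..<i}. x j \<noteq> x i) then 1 else 0 :: nat)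
          \<in> ?P \<rightarrow>\<^sub>M count_space UNIV"
      using pred_intros_logic(3)[OF 2 1] unfolding pred_def
      by (intro measurable_If measurable_const) simp_all
  qed
  moreover have "(\<Sum>i<N. if x i \<in> A \<and> (\<forall>j\<in>{..<i}. x j \<noteq> x i) then 1 else 0) = card (F x)" for x
    unfolding F_def by (simp add: sum.If_cases Int_def)
  ultimately have "(\<lambda>x. card (x ` {..<N} \<inter> A)) \<in> ?P \<rightarrow>\<^sub>M count_space UNIV"
    by (simp add: card_F)
  from measurable_sets[OF this, of "{k}"]
  have "(\<lambda>x. card (x ` {..<N} \<inter> A)) -` {k} \<inter> space ?P \<in> sets ?P"
    by simp
  also have "(\<lambda>x. card (x ` {..<N} \<inter> A)) -` {k} \<inter> space ?P =
      (\<lambda>x. x ` {..<N}) -` Y \<inter> space ?P"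
    unfolding Y by (auto simp: space_PiM sp Fpow_def PiE_def Pi_def)
  finally show "(\<lambda>x. x ` {..<N}) -` Y \<inter> space ?P \<in> sets ?P" .
qed (auto simp: Fpow_def)

lemma prob_space_poisson_process:
  assumes s: "intensity s"
  shows "prob_space (poisson_process s)"
proof -
  define r where "r = integral\<^sup>L leb01 s"
  define M where "M = density leb01 (\<lambda>x. ennreal (s x / r))"
  define K where "K N = distr (PiM {..<N} (\<lambda>_. M)) configurations (\<lambda>x. x ` {..<N})" for N :: nat
  have [measurable]: "s \<in> borel_measurable leb01"
    using s by (auto simp: intensity_def)
  have r0: "r \<ge> 0"
    unfolding r_def using s by (intro integral_nonneg_AE AE_I2) (auto simp: intensity_def space_restrict_space)
  have setsM: "sets M = sets leb01" by (simp add: M_def)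
  have total: "emeasure M (space M) = (if r = 0 then 0 else 1)"
  proof -
    have "emeasure M (space M) = (\<integral>\<^sup>+x. ennreal (s x / r) \<partial>leb01)"
      unfolding M_def space_density
      by (subst emeasure_density[OF _ sets.top]) (auto intro!: nn_integral_cong)
    also have "\<dots> = ennreal (integral\<^sup>L leb01 (\<lambda>x. s x / r))"
      using s r0 by (intro nn_integral_eq_integral AE_I2)
        (auto simp: intensity_def space_restrict_space)
    also have "\<dots> = (if r = 0 then 0 else 1)"
      by (simp add: r_def)
    finally show ?thesis .
  qed
  interpret fm: finite_measure M
    by (rule finite_measureI) (simp add: total)
  interpret product_sigma_finite "\<lambda>_::nat. M" by unfold_locales
  have meas: "(\<lambda>x. x ` {..<N}) \<in> PiM {..<N} (\<lambda>_. M) \<rightarrow>\<^sub>M configurations" for N :: nat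
    by (rule points_measurable[OF setsM])
  have tot: "emeasure (K N) (space (K N)) = (if r = 0 \<and> N \<noteq> 0 then 0 else 1)" for N
  proof -
    have "emeasure (K N) (space (K N)) =
        emeasure (PiM {..<N} (\<lambda>_. M)) (space (PiM {..<N} (\<lambda>_. M)))"
    proof -
      have "(\<lambda>x. x ` {..<N}) -` space configurations \<inter> space (PiM {..<N} (\<lambda>_. M))
          = space (PiM {..<N} (\<lambda>_. M))"
        using measurable_space[OF meas[of N]] by blast
      then show ?thesis
        using emeasure_distr[OF meas[of N] sets.top] by (simp add: K_def)
    qed
    also have "\<dots> = (\<Prod>i<N. emeasure M (space M))"
      unfolding space_PiM by (rule emeasure_PiM) auto
    finally show ?thesis by (simp add: total)
  qed
  have K: "K \<in> measure_pmf (poisson_law r) \<rightarrow>\<^sub>M subprob_algebra configurations"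
  proof -
    have "space (K N) \<noteq> {}" "sets (K N) = sets configurations" for N
      by (auto simp: K_def space_configurations Fpow_def)
    then have "K N \<in> space (subprob_algebra configurations)" for N
      unfolding space_subprob_algebra using tot[of N] by (simp add: subprob_spaceI)
    then show ?thesis by simp
  qed
  have "AE N in measure_pmf (poisson_law r). prob_space (K N)"
    by (rule AE_pmfI, rule prob_spaceI) (auto simp: tot poisson_law_def)
  from measure_pmf.prob_space_bind[OF this K] show ?thesis
    by (simp add: poisson_process_def r_def K_def[abs_def] M_def Let_def)
qed

end

theory Submission
  imports Defs
begin

text \<open>
  Every choice of some of $D$ disjoint cells of length $1/L$ gives an intensity, equal to $L$ on the
  chosen cells and to $0$ elsewhere. Since $L \ge D$, the cells fit into $[0,1]$. The indicators
  multiplied by $L$ form an orthogonal family in $L_2$ with squared norms $L$, so the $2^D$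
  intensities are the vertices of a cube in a subspace of dimension $D$.

  Each bump has integral $1$: choosing one more cell adds a Poisson number of points with mean $1$,
  and with probability $e^{-1}$ it adds none. Hence the law of the process with the larger intensity
  is at least $e^{-1}$ times the law with the smaller one (\<open>poisson_process_domination\<close>), and the
  data cannot decide well whether a given cell was chosen. More generally, on configurations of
  $N$ points the law with intensity $s$ has the density $e^{-\int s} \prod_i s(x_i) / N!$, in which
  only the factor $e^{-\int s}$ can decrease when $s$ grows.

  Assouad's argument then sums over the cells (\<open>hypercube_lower_bound\<close>). An estimator with
  coordinate $a$ along a bump has squared error $L a^2$ or $L (a - 1)^2$ in that direction, according
  to the choice of the cell. As $a^2 + (a - 1)^2 \ge 1/2$, each pair of
  neighbouring vertices contributes at least $e^{-1} L / 2$ in the direction of its edge, so the mean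
  risk over the cube is at least $D L e^{-1} / 4$. The asserted constant is smaller, because
  $e^{-1} / 4 \ge 1 / 12$.
\<close>

section \<open>Comparison of Poisson processes with ordered intensities\<close>

definition point_law :: "(real \<Rightarrow> real) \<Rightarrow> real measure" where
  "point_law s = density leb01 (\<lambda>x. ennreal (s x / integral\<^sup>L leb01 s))"

definition sample_law :: "(real \<Rightarrow> real) \<Rightarrow> nat \<Rightarrow> real set measure" where
  "sample_law s N =
     distr (PiM {..<N} (\<lambda>_. point_law s)) configurations (\<lambda>x. x ` {..<N})"

lemma sets_point_law [measurable_cong]: "sets (point_law s) = sets leb01"
  by (simp add: point_law_def)

lemma integral_intensity_nonneg: "intensity s \<Longrightarrow> 0 \<le> integral\<^sup>L leb01 s"
  by (intro integral_nonneg_AE AE_I2) (auto simp: intensity_def space_restrict_space)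

lemma subprob_space_point_law:
  assumes s: "intensity s"
  shows "subprob_space (point_law s)"
proof (rule subprob_spaceI)
  have [measurable]: "s \<in> borel_measurable leb01"
    using s by (auto simp: intensity_def)
  have "emeasure (point_law s) (space (point_law s)) =
      (\<integral>\<^sup>+x. ennreal (s x / integral\<^sup>L leb01 s) \<partial>leb01)"
    unfolding point_law_def space_density
    by (subst emeasure_density[OF _ sets.top]) (auto intro!: nn_integral_cong)
  also have "\<dots> = ennreal (integral\<^sup>L leb01 (\<lambda>x. s x / integral\<^sup>L leb01 s))"
    using s integral_intensity_nonneg[OF s]
    by (intro nn_integral_eq_integral AE_I2) (auto simp: intensity_def space_restrict_space)
  also have "\<dots> \<le> 1"
    by simp
  finally show "emeasure (point_law s) (space (point_law s)) \<le> 1" .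
  show "space (point_law s) \<noteq> {}"
    by (simp add: point_law_def space_restrict_space)
qed

lemma sample_law_measurable:
  assumes s: "intensity s"
  shows "sample_law s \<in> measure_pmf p \<rightarrow>\<^sub>M subprob_algebra configurations"
proof -
  interpret subprob_space "point_law s" by (rule subprob_space_point_law[OF s])
  interpret product_sigma_finite "\<lambda>_::nat. point_law s" by unfold_locales
  have "sample_law s N \<in> space (subprob_algebra configurations)" for N
  proof -
    have "emeasure (PiM {..<N} (\<lambda>_. point_law s)) (space (PiM {..<N} (\<lambda>_. point_law s))) =
        (\<Prod>i<N. emeasure (point_law s) (space (point_law s)))"
      unfolding space_PiM by (rule emeasure_PiM) auto
    also have "\<dots> \<le> 1"
      using emeasure_space_le_1 by (intro prod_le_1) auto
    finally have "subprob_space (PiM {..<N} (\<lambda>_. point_law s))"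
      using subprob_not_empty by (intro subprob_spaceI) (auto simp: space_PiM PiE_eq_empty_iff)
    then have "subprob_space (sample_law s N)"
      unfolding sample_law_def
      by (rule subprob_space.subprob_space_distr[OF _ points_measurable[OF sets_point_law]])
        (auto simp: space_configurations Fpow_def)
    then show ?thesis
      by (simp add: space_subprob_algebra sample_law_def)
  qed
  then show ?thesis by simp
qed

lemma nn_integral_poisson_process:
  assumes s: "intensity s" and f: "f \<in> borel_measurable configurations"
  shows "(\<integral>\<^sup>+X. f X \<partial>poisson_process s) =
    (\<integral>\<^sup>+N. ennreal (pmf (poisson_law (integral\<^sup>L leb01 s)) N) *
        (\<integral>\<^sup>+x. f (x ` {..<N}) \<partial>PiM {..<N} (\<lambda>_. point_law s)) \<partial>count_space UNIV)"
proof -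
  have "poisson_process s = measure_pmf (poisson_law (integral\<^sup>L leb01 s)) \<bind> sample_law s"
    by (simp add: poisson_process_def Let_def sample_law_def[abs_def] point_law_def)
  then have "(\<integral>\<^sup>+X. f X \<partial>poisson_process s) =
      (\<integral>\<^sup>+N. \<integral>\<^sup>+X. f X \<partial>sample_law s N \<partial>measure_pmf (poisson_law (integral\<^sup>L leb01 s)))"
    using nn_integral_bind[OF f sample_law_measurable[OF s]] by simp
  also have "\<dots> = (\<integral>\<^sup>+N. \<integral>\<^sup>+x. f (x ` {..<N}) \<partial>PiM {..<N} (\<lambda>_. point_law s)
      \<partial>measure_pmf (poisson_law (integral\<^sup>L leb01 s)))"
    unfolding sample_law_def using f
    by (intro nn_integral_cong nn_integral_distr points_measurable[OF sets_point_law]) auto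
  finally show ?thesis by (simp add: nn_integral_measure_pmf)
qed

text \<open>
  Multiplying by the total mass undoes the normalization. This also covers a null intensity, where
  $s/0$ is no probability density: then \<open>s\<close> vanishes almost everywhere and both sides are zero.
\<close>

lemma nn_integral_scaled_point_law:
  assumes s: "intensity s" and g [measurable]: "g \<in> borel_measurable leb01"
  shows "ennreal (integral\<^sup>L leb01 s) * (\<integral>\<^sup>+x. g x \<partial>point_law s) =
    (\<integral>\<^sup>+x. ennreal (s x) * g x \<partial>leb01)"
proof -
  let ?r = "integral\<^sup>L leb01 s"
  have s_int: "integrable leb01 s"
    using s by (simp add: intensity_def)
  then have [measurable]: "s \<in> borel_measurable leb01"
    by auto
  have s_nonneg: "AE x in leb01. 0 \<le> s x"
    using s by (auto simp: intensity_def space_restrict_space)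
  have "ennreal ?r * (\<integral>\<^sup>+x. g x \<partial>point_law s) =
      (\<integral>\<^sup>+x. ennreal ?r * (ennreal (s x / ?r) * g x) \<partial>leb01)"
    unfolding point_law_def by (simp add: nn_integral_density nn_integral_cmult)
  also have "\<dots> = (\<integral>\<^sup>+x. ennreal (s x) * g x \<partial>leb01)"
  proof (cases "?r = 0")
    case True
    have "AE x in leb01. s x = 0"
      using integral_nonneg_eq_0_iff_AE[OF s_int s_nonneg] True by simp
    then show ?thesis
      by (intro nn_integral_cong_AE, eventually_elim) (simp add: True)
  next
    case False
    then have r: "?r > 0" using integral_intensity_nonneg[OF s] by simp
    have "AE x in leb01. ennreal ?r * (ennreal (s x / ?r) * g x) = ennreal (s x) * g x"
      using s_nonneg
    proof eventually_elim
      case (elim x)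
      then show ?case
        using r by (simp add: mult.assoc[symmetric] ennreal_mult[symmetric])
    qed
    then show ?thesis by (rule nn_integral_cong_AE)
  qed
  finally show ?thesis .
qed

text \<open>
  The inequality between scaled measures passes to powers by Fubini, one coordinate at a time. The
  factors stay outside the measures because $r$ times the normalized law of a point is
  the quantity that increases with the intensity, while the normalized laws themselves are not ordered.
\<close>

lemma nn_integral_PiM_scaled_mono:
  fixes c c' :: ennreal and M M' :: "'a measure" and f :: "(nat \<Rightarrow> 'a) \<Rightarrow> ennreal"
  assumes "sigma_finite_measure M" "sigma_finite_measure M'"
    and sets: "sets M = sets M'"
    and le: "\<And>g. g \<in> borel_measurable M' \<Longrightarrow> c * integral\<^sup>N M g \<le> c' * integral\<^sup>N M' g"
    and f: "f \<in> borel_measurable (PiM {..<N} (\<lambda>_. M'))"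
  shows "c ^ N * (\<integral>\<^sup>+x. f x \<partial>PiM {..<N} (\<lambda>_. M)) \<le> c' ^ N * (\<integral>\<^sup>+x. f x \<partial>PiM {..<N} (\<lambda>_. M'))"
  using f
proof (induction N arbitrary: f)
  case 0
  show ?case by (simp add: PiM_empty)
next
  case (Suc N)
  interpret M: sigma_finite_measure M by fact
  interpret M': sigma_finite_measure M' by fact
  interpret P: product_sigma_finite "\<lambda>_::nat. M" by unfold_locales
  interpret P': product_sigma_finite "\<lambda>_::nat. M'" by unfold_locales
  let ?P = "PiM {..<N} (\<lambda>_. M)" and ?P' = "PiM {..<N} (\<lambda>_. M')"
  have [measurable_cong]: "sets M = sets M'" by (rule sets)
  have Suc_eq: "{..<Suc N} = insert N {..<N}" by auto
  have f: "f \<in> borel_measurable (PiM (insert N {..<N}) (\<lambda>_. M'))"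
    using Suc.prems by (simp add: Suc_eq)
  have f_M: "f \<in> borel_measurable (PiM (insert N {..<N}) (\<lambda>_. M))"
    using f by (simp add: measurable_cong_sets[OF sets_PiM_cong[OF refl sets]])
  have upd: "(\<lambda>(x, y). x(N := y)) \<in> ?P' \<Otimes>\<^sub>M M' \<rightarrow>\<^sub>M PiM (insert N {..<N}) (\<lambda>_. M')"
    by (rule measurable_add_dim)
  have f_pair: "(\<lambda>(x, y). f (x(N := y))) \<in> borel_measurable (?P' \<Otimes>\<^sub>M M')"
    using measurable_compose[OF upd f] by (simp add: case_prod_beta')
  have f_pair_M: "(\<lambda>(x, y). f (x(N := y))) \<in> borel_measurable (?P' \<Otimes>\<^sub>M M)"
    using f_pair by (simp add: measurable_cong_sets[OF sets_pair_measure_cong[OF refl sets]])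
  have slice: "(\<lambda>y. f (x(N := y))) \<in> borel_measurable M'" if "x \<in> space ?P'" for x
    using measurable_compose[OF measurable_Pair1'[OF that] f_pair] by simp
  have inner_meas: "(\<lambda>x. \<integral>\<^sup>+y. f (x(N := y)) \<partial>M') \<in> borel_measurable ?P'"
    using M'.borel_measurable_nn_integral[OF f_pair] by simp
  have inner_meas_M: "(\<lambda>x. \<integral>\<^sup>+y. f (x(N := y)) \<partial>M) \<in> borel_measurable ?P'"
    using M.borel_measurable_nn_integral[OF f_pair_M] by simp
  have "c ^ Suc N * (\<integral>\<^sup>+x. f x \<partial>PiM {..<Suc N} (\<lambda>_. M)) =
      c * (c ^ N * (\<integral>\<^sup>+x. \<integral>\<^sup>+y. f (x(N := y)) \<partial>M \<partial>?P))"
    unfolding Suc_eq by (subst P.product_nn_integral_insert[OF _ _ f_M]) (auto simp: mult.assoc)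
  also have "\<dots> \<le> c * (c' ^ N * (\<integral>\<^sup>+x. \<integral>\<^sup>+y. f (x(N := y)) \<partial>M \<partial>?P'))"
    by (intro mult_left_mono Suc.IH inner_meas_M) simp
  also have "\<dots> = c' ^ N * (\<integral>\<^sup>+x. c * (\<integral>\<^sup>+y. f (x(N := y)) \<partial>M) \<partial>?P')"
    by (simp add: nn_integral_cmult[OF inner_meas_M] mult.left_commute)
  also have "\<dots> \<le> c' ^ N * (\<integral>\<^sup>+x. c' * (\<integral>\<^sup>+y. f (x(N := y)) \<partial>M') \<partial>?P')"
    by (intro mult_left_mono nn_integral_mono le slice) auto
  also have "\<dots> = c' ^ Suc N * (\<integral>\<^sup>+x. \<integral>\<^sup>+y. f (x(N := y)) \<partial>M' \<partial>?P')"
    by (simp add: nn_integral_cmult[OF inner_meas] mult.left_commute mult.assoc)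
  also have "\<dots> = c' ^ Suc N * (\<integral>\<^sup>+x. f x \<partial>PiM {..<Suc N} (\<lambda>_. M'))"
    unfolding Suc_eq by (subst P'.product_nn_integral_insert[OF _ _ f]) auto
  finally show ?case .
qed

lemma pmf_poisson_law:
  assumes "0 \<le> r"
  shows "pmf (poisson_law r) N = exp (- r) / fact N * r ^ N"
  using assms by (cases "r = 0"; cases N) (auto simp: poisson_law_def)

text \<open>
  The process with intensity \<open>s'\<close> is the superposition of one with intensity \<open>s\<close> and one with
  intensity \<open>s' - s\<close>, and the second has no point with probability $e^{-\int (s' - s)}$. The proof
  avoids superpositions: the powers of the total masses in the Poisson weights cancel the
  normalizations of the point laws, and the contributions of each number of points compare separately.
\<close>

lemma poisson_process_domination:
  assumes s: "intensity s" and s': "intensity s'"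
    and le: "\<And>x. x \<in> {0..1} \<Longrightarrow> s x \<le> s' x"
    and f: "f \<in> borel_measurable configurations"
  shows "ennreal (exp (integral\<^sup>L leb01 s - integral\<^sup>L leb01 s')) * (\<integral>\<^sup>+X. f X \<partial>poisson_process s)
    \<le> (\<integral>\<^sup>+X. f X \<partial>poisson_process s')"
proof -
  define r r' where "r = integral\<^sup>L leb01 s" and "r' = integral\<^sup>L leb01 s'"
  have r: "0 \<le> r" "0 \<le> r'"
    using s s' by (auto simp: r_def r'_def intro: integral_intensity_nonneg)
  interpret M: subprob_space "point_law s" by (rule subprob_space_point_law[OF s])
  interpret M': subprob_space "point_law s'" by (rule subprob_space_point_law[OF s'])
  let ?J = "\<lambda>s N. \<integral>\<^sup>+x. f (x ` {..<N}) \<partial>PiM {..<N} (\<lambda>_. point_law s)"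
  have step: "ennreal r ^ N * ?J s N \<le> ennreal r' ^ N * ?J s' N" for N
  proof (rule nn_integral_PiM_scaled_mono)
    fix g :: "real \<Rightarrow> ennreal"
    assume "g \<in> borel_measurable (point_law s')"
    then have g: "g \<in> borel_measurable leb01"
      by (simp add: measurable_cong_sets[OF sets_point_law refl])
    show "ennreal r * integral\<^sup>N (point_law s) g \<le> ennreal r' * integral\<^sup>N (point_law s') g"
      unfolding r_def r'_def
        nn_integral_scaled_point_law[OF s g] nn_integral_scaled_point_law[OF s' g]
      using le by (intro nn_integral_mono mult_right_mono ennreal_leI) (auto simp: space_restrict_space)
  next
    show "(\<lambda>x. f (x ` {..<N})) \<in> borel_measurable (PiM {..<N} (\<lambda>_. point_law s'))"
      by (rule measurable_compose[OF points_measurable[OF sets_point_law] f])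
  qed (unfold_locales, simp add: sets_point_law)
  have "ennreal (exp (r - r')) * (\<integral>\<^sup>+X. f X \<partial>poisson_process s) =
      (\<integral>\<^sup>+N. ennreal (exp (r - r')) * (ennreal (pmf (poisson_law r) N) * ?J s N) \<partial>count_space UNIV)"
    by (simp add: nn_integral_poisson_process[OF s f] nn_integral_cmult r_def)
  also have "\<dots> \<le> (\<integral>\<^sup>+N. ennreal (pmf (poisson_law r') N) * ?J s' N \<partial>count_space UNIV)"
  proof (rule nn_integral_mono)
    fix N :: nat
    have split_density: "ennreal (exp (- r') / fact N * t ^ N) =
        ennreal (exp (- r') / fact N) * ennreal t ^ N" if "0 \<le> t" for t
      using that by (subst ennreal_mult) (auto simp: ennreal_power)
    have "ennreal (exp (r - r')) * (ennreal (pmf (poisson_law r) N) * ?J s N) =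
        ennreal (exp (r - r') * pmf (poisson_law r) N) * ?J s N"
      by (simp add: ennreal_mult mult.assoc)
    also have "exp (r - r') * pmf (poisson_law r) N = exp (- r') / fact N * r ^ N"
      using r by (simp add: pmf_poisson_law flip: exp_add)
    also have "ennreal (exp (- r') / fact N * r ^ N) * ?J s N =
        ennreal (exp (- r') / fact N) * (ennreal r ^ N * ?J s N)"
      using split_density[OF r(1)] by (simp add: mult.assoc)
    also have "\<dots> \<le> ennreal (exp (- r') / fact N) * (ennreal r' ^ N * ?J s' N)"
      by (intro mult_left_mono step) simp
    also have "\<dots> = ennreal (pmf (poisson_law r') N) * ?J s' N"
      using split_density[OF r(2)] by (simp add: pmf_poisson_law[OF r(2)] mult.assoc)
    finally show "ennreal (exp (r - r')) * (ennreal (pmf (poisson_law r) N) * ?J s N)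
        \<le> ennreal (pmf (poisson_law r') N) * ?J s' N" .
  qed
  also have "\<dots> = (\<integral>\<^sup>+X. f X \<partial>poisson_process s')"
    by (simp add: nn_integral_poisson_process[OF s' f] r'_def)
  finally show ?thesis by (simp add: r_def r'_def)
qed


lemma sets_poisson_process:
  assumes s: "intensity s"
  shows "sets (poisson_process s) = sets configurations"
  unfolding poisson_process_def Let_def by (subst sets_bind) auto

section \<open>A lower bound over a hypercube\<close>

text \<open>Bessel's inequality for \<open>v\<close> minus a vertex, in coordinates that put the vertices at 0-1 vectors.\<close>

lemma orthogonal_coordinates_le_norm:
  fixes v :: "'v::real_inner" and e :: "nat \<Rightarrow> 'v" and L :: real
  assumes fin: "finite J" and L: "0 < L" and sub: "\<delta> \<subseteq> J"
    and orth: "\<And>i j. i \<in> J \<Longrightarrow> j \<in> J \<Longrightarrow> inner (e i) (e j) = (if i = j then L else 0)"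
  shows "(\<Sum>j\<in>J. L * (inner v (e j) / L - of_bool (j \<in> \<delta>))\<^sup>2) \<le> (norm (v - (\<Sum>j\<in>\<delta>. e j)))\<^sup>2"
proof -
  define w where "w = v - (\<Sum>j\<in>\<delta>. e j)"
  define c where "c j = inner v (e j) / L - of_bool (j \<in> \<delta>)" for j
  define p where "p = (\<Sum>j\<in>J. c j *\<^sub>R e j)"
  have w_e: "inner w (e j) = L * c j" if "j \<in> J" for j
  proof -
    have "inner (\<Sum>i\<in>\<delta>. e i) (e j) = (\<Sum>i\<in>\<delta>. if i = j then L else 0)"
      unfolding inner_sum_left using sub that by (intro sum.cong) (auto simp: orth)
    also have "\<dots> = L * of_bool (j \<in> \<delta>)"
      using finite_subset[OF sub fin] by simp
    finally show ?thesis
      using L by (simp add: w_def c_def inner_diff_left field_simps)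
  qed
  have p_e: "inner p (e j) = L * c j" if "j \<in> J" for j
  proof -
    have "inner p (e j) = (\<Sum>i\<in>J. if i = j then L * c i else 0)"
      unfolding p_def inner_sum_left using that by (intro sum.cong) (auto simp: orth)
    then show ?thesis
      using fin that by simp
  qed
  have "inner w p = (\<Sum>j\<in>J. L * (c j)\<^sup>2)" "inner p p = (\<Sum>j\<in>J. L * (c j)\<^sup>2)"
    by (auto simp: p_def inner_sum_right w_e p_e[unfolded p_def] power2_eq_square intro!: sum.cong)
  moreover have "0 \<le> inner (w - p) (w - p)"
    by simp
  ultimately show ?thesis
    by (simp add: inner_diff_left inner_diff_right inner_commute power2_norm_eq_inner
        flip: w_def c_def)
qed

lemma sum_Pow_insert:
  fixes g :: "'a set \<Rightarrow> 'b::comm_monoid_add"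
  assumes "finite A" "j \<notin> A"
  shows "sum g (Pow (insert j A)) = (\<Sum>\<delta>\<in>Pow A. g \<delta> + g (insert j \<delta>))"
proof -
  have "inj_on (insert j) (Pow A)"
    using assms by (auto simp: inj_on_def)
  moreover have "Pow A \<inter> insert j ` Pow A = {}"
    using assms by auto
  ultimately show ?thesis
    using assms by (simp add: Pow_insert sum.union_disjoint sum.reindex sum.distrib)
qed

text \<open>
  Le Cam's two-point argument for a parameter in $\{0, 1\}$. Domination by the factor \<open>c\<close>
  replaces the usual bound on the affinity of the two laws: both errors can be measured under
  the same \<open>P\<close>, and no number is close to both 0 and 1.
\<close>

lemma two_point_bound:
  fixes a :: "'x \<Rightarrow> real" and c :: real
  assumes "prob_space P" and a [measurable]: "a \<in> borel_measurable P" and c: "0 \<le> c" "c \<le> 1"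
    and dom: "ennreal c * (\<integral>\<^sup>+X. ennreal ((a X - 1)\<^sup>2) \<partial>P) \<le> (\<integral>\<^sup>+X. ennreal ((a X - 1)\<^sup>2) \<partial>P')"
  shows "ennreal (c / 2) \<le> (\<integral>\<^sup>+X. ennreal ((a X)\<^sup>2) \<partial>P) + (\<integral>\<^sup>+X. ennreal ((a X - 1)\<^sup>2) \<partial>P')"
proof -
  interpret prob_space P by fact
  \<comment> \<open>The difference of the two sides is $(2t - 1)^2 / 2$.\<close>
  have half: "1 / 2 \<le> t\<^sup>2 + (t - 1)\<^sup>2" for t :: real
    using zero_le_power2[of "2 * t - 1"] by (simp add: power2_eq_square algebra_simps)
  have "ennreal (c / 2) = ennreal c * (\<integral>\<^sup>+X. ennreal (1 / 2) \<partial>P)"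
  proof -
    have "ennreal (c / 2) = ennreal c * ennreal (1 / 2)"
      using c by (simp only: ennreal_mult[symmetric]) simp
    then show ?thesis by (simp only: nn_integral_const emeasure_space_1 mult_1_right)
  qed
  also have "\<dots> \<le> ennreal c * (\<integral>\<^sup>+X. ennreal ((a X)\<^sup>2) + ennreal ((a X - 1)\<^sup>2) \<partial>P)"
    by (intro mult_left_mono nn_integral_mono)
      (simp_all only: ennreal_plus[symmetric] zero_le_power2 ennreal_leI half zero_le)
  also have "\<dots> = ennreal c * (\<integral>\<^sup>+X. ennreal ((a X)\<^sup>2) \<partial>P) +
      ennreal c * (\<integral>\<^sup>+X. ennreal ((a X - 1)\<^sup>2) \<partial>P)"
    by (simp add: nn_integral_add distrib_left)
  also have "\<dots> \<le> 1 * (\<integral>\<^sup>+X. ennreal ((a X)\<^sup>2) \<partial>P) + (\<integral>\<^sup>+X. ennreal ((a X - 1)\<^sup>2) \<partial>P')"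
    using c by (intro add_mono mult_right_mono dom) auto
  finally show ?thesis by simp
qed

text \<open>
  Assouad's lemma: the supremum is at least the mean over all vertices, the squared error splits into
  coordinates, and in the direction \<open>j\<close> the vertices split into pairs that differ only in \<open>j\<close>.
\<close>

lemma hypercube_lower_bound:
  fixes e :: "nat \<Rightarrow> 'v::real_inner" and P :: "nat set \<Rightarrow> 'x measure" and t :: "'x \<Rightarrow> 'v"
    and L c :: real
  assumes fin: "finite J" and L: "0 < L" and c: "0 \<le> c" "c \<le> 1"
    and orth: "\<And>i j. i \<in> J \<Longrightarrow> j \<in> J \<Longrightarrow> inner (e i) (e j) = (if i = j then L else 0)"
    and prob: "\<And>\<delta>. \<delta> \<subseteq> J \<Longrightarrow> prob_space (P \<delta>)"
    and sets: "\<And>\<delta>. \<delta> \<subseteq> J \<Longrightarrow> sets (P \<delta>) = sets Q"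
    and t: "t \<in> Q \<rightarrow>\<^sub>M borel"
    and dom: "\<And>\<delta> j f. \<delta> \<subseteq> J \<Longrightarrow> j \<in> J - \<delta> \<Longrightarrow> f \<in> borel_measurable Q \<Longrightarrow>
      ennreal c * (\<integral>\<^sup>+X. f X \<partial>P \<delta>) \<le> (\<integral>\<^sup>+X. f X \<partial>P (insert j \<delta>))"
  shows "ennreal (card J * L * c / 4) \<le>
    (SUP \<delta>\<in>Pow J. \<integral>\<^sup>+X. ennreal ((norm (t X - (\<Sum>j\<in>\<delta>. e j)))\<^sup>2) \<partial>P \<delta>)"
    (is "_ \<le> (SUP \<delta>\<in>_. ?R \<delta>)")
proof -
  define a where "a j X = inner (t X) (e j) / L" for j X
  define B where "B j \<delta> = (\<integral>\<^sup>+X. ennreal ((a j X - of_bool (j \<in> \<delta>))\<^sup>2) \<partial>P \<delta>)" for j \<delta>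
  have "(\<lambda>X. inner (t X) (e j)) \<in> borel_measurable Q" for j
    using measurable_compose[OF t borel_measurable_continuous_onI[of "\<lambda>v. inner v (e j)"]]
    by (simp add: continuous_intros)
  then have a [measurable]: "a j \<in> borel_measurable Q" for j
    unfolding a_def by simp
  have risk: "(\<Sum>j\<in>J. ennreal L * B j \<delta>) \<le> ?R \<delta>" if \<delta>: "\<delta> \<subseteq> J" for \<delta>
  proof -
    note [measurable_cong] = sets[OF \<delta>]
    have "(\<Sum>j\<in>J. ennreal L * B j \<delta>) =
        (\<integral>\<^sup>+X. (\<Sum>j\<in>J. ennreal L * ennreal ((a j X - of_bool (j \<in> \<delta>))\<^sup>2)) \<partial>P \<delta>)"
      unfolding B_def by (simp add: nn_integral_sum nn_integral_cmult)
    also have "\<dots> = (\<integral>\<^sup>+X. ennreal (\<Sum>j\<in>J. L * (a j X - of_bool (j \<in> \<delta>))\<^sup>2) \<partial>P \<delta>)"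
      using L by (intro nn_integral_cong) (simp add: sum_ennreal flip: ennreal_mult)
    also have "\<dots> \<le> ?R \<delta>"
      unfolding a_def using orthogonal_coordinates_le_norm[OF fin L \<delta> orth]
      by (intro nn_integral_mono ennreal_leI) auto
    finally show ?thesis .
  qed
  have coordinate: "2 ^ card J * ennreal (c / 4) \<le> (\<Sum>\<delta>\<in>Pow J. B j \<delta>)" if j: "j \<in> J" for j
  proof -
    have J: "J = insert j (J - {j})" using j by auto
    have "2 ^ card J * ennreal (c / 4) = (\<Sum>\<delta>\<in>Pow (J - {j}). ennreal (c / 2))"
    proof -
      have "card J = Suc (card (J - {j}))"
        using card_Suc_Diff1[OF fin j] by simp
      moreover have "2 * ennreal (c / 4) = ennreal (c / 2)"
        using c by (simp flip: ennreal_numeral ennreal_mult)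
      ultimately show ?thesis
        using fin by (simp add: card_Pow mult.left_commute[of 2] mult.assoc)
    qed
    also have "\<dots> \<le> (\<Sum>\<delta>\<in>Pow (J - {j}). B j \<delta> + B j (insert j \<delta>))"
    proof (rule sum_mono)
      fix \<delta> assume "\<delta> \<in> Pow (J - {j})"
      then have \<delta>: "\<delta> \<subseteq> J" "j \<in> J - \<delta>" using j by auto
      note [measurable_cong] = sets[OF \<delta>(1)]
      show "ennreal (c / 2) \<le> B j \<delta> + B j (insert j \<delta>)"
        using two_point_bound[OF prob[OF \<delta>(1)] _ c dom[OF \<delta>], of "a j"] \<delta> by (simp add: B_def)
    qed
    also have "\<dots> = (\<Sum>\<delta>\<in>Pow J. B j \<delta>)"
      by (subst (2) J, subst sum_Pow_insert) (use fin in auto)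
    finally show ?thesis .
  qed
  have "2 ^ card J * ennreal (card J * L * c / 4) = (\<Sum>j\<in>J. ennreal L * (2 ^ card J * ennreal (c / 4)))"
  proof -
    have "ennreal (card J * L * c / 4) = of_nat (card J) * (ennreal L * ennreal (c / 4))"
      using L c by (simp add: ennreal_of_nat_eq_real_of_nat flip: ennreal_mult)
    then show ?thesis
      by (simp add: mult_ac)
  qed
  also have "\<dots> \<le> (\<Sum>j\<in>J. ennreal L * (\<Sum>\<delta>\<in>Pow J. B j \<delta>))"
    by (intro sum_mono mult_left_mono coordinate) auto
  also have "\<dots> = (\<Sum>\<delta>\<in>Pow J. \<Sum>j\<in>J. ennreal L * B j \<delta>)"
    unfolding sum_distrib_left by (rule sum.swap)
  also have "\<dots> \<le> (\<Sum>\<delta>\<in>Pow J. SUP \<delta>\<in>Pow J. ?R \<delta>)"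
    by (intro sum_mono order_trans[OF risk] SUP_upper) auto
  also have "\<dots> = 2 ^ card J * (SUP \<delta>\<in>Pow J. ?R \<delta>)"
    using fin by (simp add: card_Pow)
  finally show ?thesis
    by (subst (asm) ennreal_mult_le_mult_iff) (auto simp: power_eq_top_ennreal)
qed

section \<open>Sums of disjoint bumps\<close>

definition bump :: "nat \<Rightarrow> real \<Rightarrow> nat \<Rightarrow> real \<Rightarrow> real" where
  "bump D L j x = L * indicator {j / D ..< j / D + 1 / L} x"

definition bump_sum :: "nat \<Rightarrow> real \<Rightarrow> nat set \<Rightarrow> real \<Rightarrow> real" where
  "bump_sum D L \<delta> x = (\<Sum>j\<in>\<delta>. bump D L j x)"

lemma l2_class_add:
  "square_integrable f \<Longrightarrow> square_integrable g \<Longrightarrow>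
    l2_class (\<lambda>x. f x + g x) = l2_class f + l2_class g"
  by (simp add: l2_class_def plus_l2.abs_eq eq_onp_def)

lemma l2_class_zero: "l2_class (\<lambda>_. 0) = 0"
  by (simp add: l2_class_def zero_l2_def)

lemma inner_l2_class:
  "square_integrable f \<Longrightarrow> square_integrable g \<Longrightarrow>
    inner (l2_class f) (l2_class g) = integral\<^sup>L leb01 (\<lambda>x. f x * g x)"
  by (simp add: l2_class_def inner_l2.abs_eq eq_onp_def)

lemma finite_measure_leb01: "finite_measure leb01"
  by (rule finite_measureI) (simp add: emeasure_restrict_space space_restrict_space)

context
  fixes D :: nat and L :: real
  assumes D: "1 \<le> D" and L: "real D \<le> L"
begin

lemma L_pos: "0 < L"
  using D L by linarith

lemma bump_measurable [measurable]: "bump D L j \<in> borel_measurable leb01"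
  unfolding bump_def[abs_def] by (intro measurable_restrict_space1) simp

lemma bump_bounds: "0 \<le> bump D L j x" "bump D L j x \<le> L"
  using L_pos by (auto simp: bump_def indicator_def)

lemma bump_mult: "bump D L i x * bump D L j x = (if i = j then L * bump D L j x else 0)"
proof (cases "i = j")
  case False
  \<comment> \<open>Cells have length at most $1/D$, so a point of a cell determines the index of the cell.\<close>
  have index: "\<lfloor>x * D\<rfloor> = int k" if "bump D L k x \<noteq> 0" for k
  proof -
    have x: "k / D \<le> x" "x < k / D + 1 / L"
      using that by (auto simp: bump_def indicator_def split: if_splits)
    have "1 / L \<le> 1 / D"
      using D L by (intro divide_left_mono) auto
    with x have "x < (k + 1) / D"
      by (simp add: add_divide_distrib)
    with x D have "k \<le> x * D" "x * D < k + 1"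
      by (auto simp: field_simps)
    then show ?thesis by (simp add: floor_eq_iff)
  qed
  then show ?thesis using False by (metis mult_eq_0_iff of_nat_eq_iff)
qed (auto simp: bump_def indicator_def)

lemma integrable_bump: "integrable leb01 (bump D L j)"
proof -
  interpret finite_measure leb01 by (rule finite_measure_leb01)
  show ?thesis
    using bump_bounds by (intro integrable_const_bound[where B = L]) auto
qed

lemma integral_bump:
  assumes "j < D"
  shows "integral\<^sup>L leb01 (bump D L j) = 1"
proof -
  let ?I = "{j / D ..< j / D + 1 / L}"
  have "1 / L \<le> 1 / D"
    using D L by (intro divide_left_mono) auto
  then have "j / D + 1 / L \<le> (j + 1) / D"
    by (simp add: add_divide_distrib)
  also have "\<dots> \<le> 1"
    using assms by simp
  finally have sub: "?I \<subseteq> {0..1}"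
    by auto (meson divide_nonneg_nonneg of_nat_0_le_iff order_trans)
  have "integral\<^sup>L leb01 (bump D L j) = L * measure leb01 ?I"
    using sub by (simp add: bump_def[abs_def] space_restrict_space Int_absorb2)
  also have "measure leb01 ?I = 1 / L"
    using sub L_pos by (simp add: measure_restrict_space)
  finally show ?thesis
    using L_pos by simp
qed

lemma square_integrable_bump: "square_integrable (bump D L j)"
  using integrable_bump by (simp add: square_integrable_def power2_eq_square bump_mult)

lemma inner_bump:
  assumes "j < D"
  shows "inner (l2_class (bump D L i)) (l2_class (bump D L j)) = (if i = j then L else 0)"
  using integral_bump[OF assms] by (simp add: inner_l2_class square_integrable_bump bump_mult)

lemma bump_sum_insert:
  "finite \<delta> \<Longrightarrow> j \<notin> \<delta> \<Longrightarrow> bump_sum D L (insert j \<delta>) = (\<lambda>x. bump D L j x + bump_sum D L \<delta> x)"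
  by (simp add: bump_sum_def[abs_def])

lemma l2_class_bump_sum:
  assumes "finite \<delta>"
  shows "square_integrable (bump_sum D L \<delta>) \<and>
    l2_class (bump_sum D L \<delta>) = (\<Sum>j\<in>\<delta>. l2_class (bump D L j))"
  using assms
proof induction
  case empty
  show ?case by (simp add: bump_sum_def[abs_def] square_integrable_zero l2_class_zero)
next
  case (insert j \<delta>)
  then show ?case
    by (simp add: bump_sum_insert square_integrable_add square_integrable_bump l2_class_add)
qed

lemma intensity_bump_sum: "intensity (bump_sum D L \<delta>)"
  using bump_bounds integrable_bump
  by (auto simp: intensity_def bump_sum_def[abs_def] intro!: sum_nonneg)

lemma bump_sum_le:
  assumes "finite \<delta>"
  shows "bump_sum D L \<delta> x \<le> L"
proof (cases "\<exists>j\<in>\<delta>. bump D L j x \<noteq> 0")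
  case True
  then obtain j where j: "j \<in> \<delta>" "bump D L j x \<noteq> 0" by auto
  then have "bump D L i x = 0" if "i \<noteq> j" for i
    using bump_mult[of i x j] that by simp
  then have "bump_sum D L \<delta> x = (\<Sum>i\<in>\<delta>. if i = j then bump D L i x else 0)"
    unfolding bump_sum_def by (intro sum.cong) auto
  then show ?thesis
    using j bump_bounds assms by simp
qed (use L_pos in \<open>simp add: bump_sum_def\<close>)

lemma Linf_norm_bump_sum:
  assumes "finite \<delta>"
  shows "Linf_norm (bump_sum D L \<delta>) \<le> ereal L"
proof -
  have "0 \<le> bump_sum D L \<delta> x" for x
    unfolding bump_sum_def by (intro sum_nonneg bump_bounds)
  then show ?thesis
    unfolding Linf_norm_def using bump_sum_le[OF assms] intensity_bump_sum[of \<delta>]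
    by (intro esssup_I) (auto simp: intensity_def)
qed

lemma integral_bump_sum_insert:
  assumes "finite \<delta>" "j \<notin> \<delta>" "j < D"
  shows "integral\<^sup>L leb01 (bump_sum D L (insert j \<delta>)) = 1 + integral\<^sup>L leb01 (bump_sum D L \<delta>)"
  using assms intensity_bump_sum[of \<delta>]
  by (simp add: bump_sum_insert integrable_bump integral_bump intensity_def)

lemma poisson_bump_sum_domination:
  assumes "finite \<delta>" "j \<notin> \<delta>" "j < D" and f: "f \<in> borel_measurable configurations"
  shows "ennreal (exp (- 1)) * (\<integral>\<^sup>+X. f X \<partial>poisson_process (bump_sum D L \<delta>))
    \<le> (\<integral>\<^sup>+X. f X \<partial>poisson_process (bump_sum D L (insert j \<delta>)))"
proof -
  have "bump_sum D L \<delta> x \<le> bump_sum D L (insert j \<delta>) x" for x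
    using assms bump_bounds by (simp add: bump_sum_insert)
  from poisson_process_domination[OF intensity_bump_sum intensity_bump_sum this f] show ?thesis
    using integral_bump_sum_insert[OF assms(1-3)] by simp
qed

lemma affine_subspace_bump_span:
  "affine_subspace_dim (span ((\<lambda>j. l2_class (bump D L j)) ` {..<D})) D"
proof -
  let ?e = "\<lambda>j. l2_class (bump D L j)"
  have inj: "inj_on ?e {..<D}"
    using inner_bump L_pos by (intro inj_onI) (metis lessThan_iff less_irrefl)
  have "pairwise orthogonal (?e ` {..<D})"
    using inner_bump by (auto simp: pairwise_def orthogonal_def)
  moreover have "0 \<notin> ?e ` {..<D}"
  proof
    assume "0 \<in> ?e ` {..<D}"
    then obtain j where "j < D" "?e j = 0" by auto
    then show False using inner_bump[of j j] L_pos by simp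
  qed
  ultimately have "independent (?e ` {..<D})"
    by (rule pairwise_orthogonal_independent)
  then show ?thesis
    unfolding affine_subspace_dim_def using inj
    by (intro exI[of _ 0] exI[of _ "?e ` {..<D}"]) (simp add: card_image)
qed

lemma bump_sum_risk:
  assumes t: "t \<in> configurations \<rightarrow>\<^sub>M borel"
  shows "ennreal (real D * L * exp (- 1) / 4) \<le>
    (SUP \<delta>\<in>Pow {..<D}. \<integral>\<^sup>+X. ennreal ((norm (t X - l2_class (bump_sum D L \<delta>)))\<^sup>2)
       \<partial>poisson_process (bump_sum D L \<delta>))"
proof -
  have fin: "finite \<delta>" if "\<delta> \<subseteq> {..<D}" for \<delta>
    using that finite_subset by blast
  have "ennreal (card {..<D} * L * exp (- 1) / 4) \<le>
    (SUP \<delta>\<in>Pow {..<D}. \<integral>\<^sup>+X. ennreal ((norm (t X - (\<Sum>j\<in>\<delta>. l2_class (bump D L j))))\<^sup>2)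
       \<partial>poisson_process (bump_sum D L \<delta>))"
  proof (rule hypercube_lower_bound)
    show "prob_space (poisson_process (bump_sum D L \<delta>))" for \<delta>
      by (intro prob_space_poisson_process intensity_bump_sum)
    show "sets (poisson_process (bump_sum D L \<delta>)) = sets configurations" for \<delta>
      by (intro sets_poisson_process intensity_bump_sum)
  qed (use t L_pos fin in \<open>auto simp: inner_bump intro!: poisson_bump_sum_domination\<close>)
  also have "\<dots> = (SUP \<delta>\<in>Pow {..<D}. \<integral>\<^sup>+X. ennreal ((norm (t X - l2_class (bump_sum D L \<delta>)))\<^sup>2)
       \<partial>poisson_process (bump_sum D L \<delta>))"
    using l2_class_bump_sum[OF fin] by (intro SUP_cong) auto
  finally show ?thesis by simp
qed

end

theorem corollary1:
  fixes D :: nat and L :: real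
  assumes "D \<ge> 1" and "L \<ge> 3 * real D / 2"
  shows "\<exists>S :: (real \<Rightarrow> real) set.
    finite S \<and>
    (\<forall>s\<in>S. intensity s \<and> square_integrable s) \<and>
    (\<exists>A. affine_subspace_dim A D \<and> l2_class ` S \<subseteq> A) \<and>
    (SUP s\<in>S. Linf_norm s) \<le> ereal L \<and>
    (\<forall>s_hat :: real set \<Rightarrow> l2. s_hat \<in> configurations \<rightarrow>\<^sub>M borel \<longrightarrow>
       (SUP s\<in>S. \<integral>\<^sup>+X. ennreal ((norm (s_hat X - l2_class s))\<^sup>2) \<partial>poisson_process s)
         \<ge> ennreal ((real D * L / 24) * exp (- 2 / 7)))"
proof -
  have D: "1 \<le> D" and L: "real D \<le> L"
    using assms by auto
  note bumps = l2_class_bump_sum[OF D L] intensity_bump_sum[OF D L] Linf_norm_bump_sum[OF D L]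
  have fin: "finite \<delta>" if "\<delta> \<subseteq> {..<D}" for \<delta>
    using that finite_subset by blast
  let ?S = "bump_sum D L ` Pow {..<D}"
  let ?A = "span ((\<lambda>j. l2_class (bump D L j)) ` {..<D})"
  have const_le: "real D * L / 24 * exp (- 2 / 7) \<le> real D * L * exp (- 1) / 4"
  proof -
    have "exp (- 2 / 7 :: real) \<le> 1 * exp 0"
      by simp
    also have "\<dots> \<le> 6 * exp (- 1 :: real)"
      using exp_le by (simp add: exp_minus field_simps)
    finally show ?thesis
      using L D mult_left_mono[of "exp (- 2 / 7)" "6 * exp (- 1)" "real D * L"] by simp
  qed
  show ?thesis
  proof (intro exI[of _ ?S] conjI allI impI ballI)
    show "finite ?S" by simp
    show "intensity s" "square_integrable s" if "s \<in> ?S" for s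
      using that bumps fin by auto
    have "(\<Sum>j\<in>\<delta>. l2_class (bump D L j)) \<in> ?A" if "\<delta> \<subseteq> {..<D}" for \<delta>
      using that by (intro span_sum span_base) auto
    then have "l2_class ` ?S \<subseteq> ?A"
      using bumps(1) fin by auto
    then show "\<exists>A. affine_subspace_dim A D \<and> l2_class ` ?S \<subseteq> A"
      using affine_subspace_bump_span[OF D L] by blast
    show "(SUP s\<in>?S. Linf_norm s) \<le> ereal L"
      using bumps(3) fin by (auto intro!: SUP_least)
    fix s_hat :: "real set \<Rightarrow> l2"
    assume s_hat: "s_hat \<in> configurations \<rightarrow>\<^sub>M borel"
    have "ennreal (real D * L / 24 * exp (- 2 / 7)) \<le> ennreal (real D * L * exp (- 1) / 4)"
      by (intro ennreal_leI const_le)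
    also note bump_sum_risk[OF D L s_hat]
    finally show "ennreal (real D * L / 24 * exp (- 2 / 7)) \<le>
      (SUP s\<in>?S. \<integral>\<^sup>+X. ennreal ((norm (s_hat X - l2_class s))\<^sup>2) \<partial>poisson_process s)"
      by (simp add: image_image)
  qed
qed

end
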